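(* Let $\mathcal N=(\mathrm{ST},\{N_C\}_{C\subseteq\mathrm{AG}})$ be an actual neighborhood frame, where $\mathrm{AG}$ is finite and nonempty. Then $\mathcal N$ is AC-representative (in the finite-agent sense) if and only if $\mathcal N$ is AC-abstract-representative.
   Context: Let $\mathrm{AG}$ be a finite nonempty set of agents; coalitions are subsets of $\mathrm{AG}$. An actual neighborhood frame is $\mathcal N=(\mathrm{ST},\{N_C\}_{C\subseteq\mathrm{AG}})$ with $\mathrm{ST}$ a nonempty set and $N_C:\mathrm{ST}\to\mathcal P(\mathcal P(\mathrm{ST}))$. **Abstract side.** An abstract actual presentation of $\mathcal N$ at $s$ is a tuple $\mathbb I_s=(I_s,o_s,\{\equiv^s_a\}_{a\in\mathrm{AG}})$ where $I_s$ is a (possibly empty) set, $o_s:I_s\to\mathcal P(\mathrm{ST})$, and each $\equiv^s_a$ is an equivalence relation on $I_s$. For $C\subseteq\mathrm{AG}$, $i\equiv^s_C j$ iff $i\equiv^s_a j$ for all $a\in C$ (universal relation if $C=\emptyset$), and $\rho^s_C(i)=\bigcup\{o_s(j)\mid j\in I_s,\ i\equiv^s_C j\}$. It must satisfy: (grand compatibility) $i\equiv^s_{\mathrm{AG}}j$ implies $o_s(i)=o_s(j)$; (coverage) $N_C(s)=\{\rho^s_C(i)\mid i\in I_s\}$ for every $C\subseteq\mathrm{AG}$. An abstract actual presentation of $\mathcal N$ is a family $(\mathbb I_s)_{s\in\mathrm{ST}}$ of such presentations, one at each $s$. $\mathcal N$ is AC-abstract-representative if it has an abstract actual presentation and satisfies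 liveness: $\emptyset\notin N_C(s)$ for all $s\in\mathrm{ST}$, $C\subseteq\mathrm{AG}$. **Profile side.** A power profile at $s$ is a family $\gamma=(\gamma_C)_{C\subseteq\mathrm{AG}}$ with $\gamma_C\in N_C(s)$ for all $C$ and $\gamma_D\subseteq\gamma_C$ whenever $C\subseteq D\subseteq\mathrm{AG}$. $\Gamma_s$ is the set of power profiles at $s$ (possibly empty). For $\gamma,\delta\in\Gamma_s$, $\gamma\equiv^s_C\delta$ means $\gamma_D=\delta_D$ for every $D\subseteq C$. A set $\Omega\subseteq\Gamma_s$ is coherent if for every $\gamma\in\Omega$ and $C\subseteq\mathrm{AG}$, $\gamma_C=\bigcup\{\delta_{\mathrm{AG}}\mid\delta\in\Omega,\ \delta\equiv^s_C\gamma\}$. A coherent profile cover at $s$ is a coherent $\Omega_s\subseteq\Gamma_s$ with $N_C(s)=\{\gamma_C\mid\gamma\in\Omega_s\}$ for every $C\subseteq\mathrm{AG}$. $\mathcal N$ is (finite-agent) AC-representative if: (1) for every $s$, if $N_\emptyset(s)$ is nonempty then it is a singleton; (2) $\emptyset\notin N_C(s)$ for all $s,C$; (3) for every $s\in\mathrm{ST}$ there exists a (possibly empty) coherent profile cover at $s$. *)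

theory Defs
  imports "HOL-Library.FuncSet"
begin

type_synonym ('ag, 'st) nbhd = "'ag set \<Rightarrow> 'st \<Rightarrow> 'st set set"

definition actual_neighborhood_frame ::
    "'ag set \<Rightarrow> 'st set \<Rightarrow> ('ag, 'st) nbhd \<Rightarrow> bool" where
  "actual_neighborhood_frame AG ST N \<longleftrightarrow>
     ST \<noteq> {} \<and> (\<forall>C s. C \<subseteq> AG \<longrightarrow> s \<in> ST \<longrightarrow> N C s \<subseteq> Pow ST)"

definition live :: "'ag set \<Rightarrow> 'st set \<Rightarrow> ('ag, 'st) nbhd \<Rightarrow> bool" where
  "live AG ST N \<longleftrightarrow> (\<forall>s C. s \<in> ST \<longrightarrow> C \<subseteq> AG \<longrightarrow> {} \<notin> N C s)"


subsection \<open>Abstract presentations\<close>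

record ('i, 'ag, 'st) presentation =
  index :: "'i set"
  outcome :: "'i \<Rightarrow> 'st set"
  indist :: "'ag \<Rightarrow> ('i \<times> 'i) set"

definition coalition_indist ::
    "('i, 'ag, 'st) presentation \<Rightarrow> 'ag set \<Rightarrow> ('i \<times> 'i) set" where
  "coalition_indist P C =
     {(i, j). i \<in> index P \<and> j \<in> index P \<and> (\<forall>a\<in>C. (i, j) \<in> indist P a)}"

definition rho :: "('i, 'ag, 'st) presentation \<Rightarrow> 'ag set \<Rightarrow> 'i \<Rightarrow> 'st set" where
  "rho P C i = \<Union> {outcome P j | j. j \<in> index P \<and> (i, j) \<in> coalition_indist P C}"

definition abstract_presentation_at ::
    "'ag set \<Rightarrow> 'st set \<Rightarrow> ('ag, 'st) nbhd \<Rightarrow> 'st \<Rightarrow> ('i, 'ag, 'st) presentation \<Rightarrow> bool" where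
  "abstract_presentation_at AG ST N s P \<longleftrightarrow>
     outcome P \<in> index P \<rightarrow> Pow ST \<and>
     (\<forall>a\<in>AG. equiv (index P) (indist P a)) \<and>
     (\<forall>i j. (i, j) \<in> coalition_indist P AG \<longrightarrow> outcome P i = outcome P j) \<and>
     (\<forall>C. C \<subseteq> AG \<longrightarrow> N C s = {rho P C i | i. i \<in> index P})"

text \<open>
  HOL cannot quantify existentially over the type of indices, so the type in which the
  index sets live is a parameter.
\<close>

definition AC_abstract_representative ::
    "'i itself \<Rightarrow> 'ag set \<Rightarrow> 'st set \<Rightarrow> ('ag, 'st) nbhd \<Rightarrow> bool" where
  "AC_abstract_representative (_ :: 'i itself) AG ST N \<longleftrightarrow>
     (\<exists>\<I> :: 'st \<Rightarrow> ('i, 'ag, 'st) presentation.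
        \<forall>s\<in>ST. abstract_presentation_at AG ST N s (\<I> s)) \<and>
     live AG ST N"

text \<open>
  A type with room for an index set whenever any type has one. Its elements assign to each
  agent a family of sets of states. Profiles with their own equivalences would not do: agreement of two
  profiles on all subsets of \<open>C\<close> does not follow from agreement on all subsets of \<open>{a}\<close> for
  each \<open>a \<in> C\<close>. One can instead index by families of shares \<open>x a D\<close> (\<open>a \<in> D\<close>) whose
  symmetric difference over \<open>a \<in> D\<close> is the \<open>D\<close>-component of a profile.
\<close>

type_synonym ('ag, 'st) index_universe = "'ag \<Rightarrow> 'ag set \<Rightarrow> 'st set"


subsection \<open>Power profiles\<close>

text \<open>
  Profiles are families indexed by the subsets of \<open>AG\<close>; \<open>\<Pi>\<^sub>E\<close> fixes the values elsewhere, so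
  that equality of profiles is equality of families.
\<close>

definition power_profiles ::
    "'ag set \<Rightarrow> ('ag, 'st) nbhd \<Rightarrow> 'st \<Rightarrow> ('ag set \<Rightarrow> 'st set) set" where
  "power_profiles AG N s =
     {\<gamma> \<in> (\<Pi>\<^sub>E C\<in>Pow AG. N C s). \<forall>C D. C \<subseteq> D \<longrightarrow> D \<subseteq> AG \<longrightarrow> \<gamma> D \<subseteq> \<gamma> C}"

definition profile_equiv ::
    "'ag set \<Rightarrow> ('ag set \<Rightarrow> 'st set) \<Rightarrow> ('ag set \<Rightarrow> 'st set) \<Rightarrow> bool" where
  "profile_equiv C \<gamma> \<delta> \<longleftrightarrow> (\<forall>D. D \<subseteq> C \<longrightarrow> \<gamma> D = \<delta> D)"

definition coherent :: "'ag set \<Rightarrow> ('ag set \<Rightarrow> 'st set) set \<Rightarrow> bool" where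
  "coherent AG \<Omega> \<longleftrightarrow>
     (\<forall>\<gamma>\<in>\<Omega>. \<forall>C. C \<subseteq> AG \<longrightarrow> \<gamma> C = \<Union> {\<delta> AG | \<delta>. \<delta> \<in> \<Omega> \<and> profile_equiv C \<delta> \<gamma>})"

definition coherent_profile_cover ::
    "'ag set \<Rightarrow> ('ag, 'st) nbhd \<Rightarrow> 'st \<Rightarrow> ('ag set \<Rightarrow> 'st set) set \<Rightarrow> bool" where
  "coherent_profile_cover AG N s \<Omega> \<longleftrightarrow>
     \<Omega> \<subseteq> power_profiles AG N s \<and> coherent AG \<Omega> \<and>
     (\<forall>C. C \<subseteq> AG \<longrightarrow> N C s = {\<gamma> C | \<gamma>. \<gamma> \<in> \<Omega>})"

definition AC_representative ::
    "'ag set \<Rightarrow> 'st set \<Rightarrow> ('ag, 'st) nbhd \<Rightarrow> bool" where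
  "AC_representative AG ST N \<longleftrightarrow>
     (\<forall>s\<in>ST. N {} s \<noteq> {} \<longrightarrow> is_singleton (N {} s)) \<and>
     live AG ST N \<and>
     (\<forall>s\<in>ST. \<exists>\<Omega>. coherent_profile_cover AG N s \<Omega>)"

end

(* A presentation yields the profiles C \<mapsto> rho C i, which are coherent because \<equiv>_C-related indices
   have the same rho D for all D \<subseteq> C. Conversely, the profiles of a coherent cover cannot serve as
   indices themselves, since agent-wise agreement does not give agreement on coalitions. Instead each
   component \<gamma> D is split into shares of the members of D by symmetric difference. Any coalition
   with a member outside C can have its component set to an arbitrary value by changing the share of
   such a member only, so fixing the shares of C determines exactly the components below C. *)

theory Submission
  imports Defs
begin

subsection \<open>From presentations to covers\<close>

lemma coalition_indist_refl:
  assumes "\<forall>a\<in>AG. equiv (index P) (indist P a)" "C \<subseteq> AG" "i \<in> index P"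
  shows "(i, i) \<in> coalition_indist P C"
  using assms by (auto simp: coalition_indist_def equiv_def refl_on_def)

lemma coalition_indist_antimono:
  "C \<subseteq> D \<Longrightarrow> coalition_indist P D \<subseteq> coalition_indist P C"
  by (auto simp: coalition_indist_def)

lemma rho_antimono: "C \<subseteq> D \<Longrightarrow> rho P D i \<subseteq> rho P C i"
  unfolding rho_def using coalition_indist_antimono[of C D P] by blast

text \<open>Agent by agent, symmetry and transitivity give \<open>i\<close> and \<open>j\<close> the
  same related indices, so both unions run over one class.\<close>

lemma rho_eq:
  assumes eq: "\<forall>a\<in>AG. equiv (index P) (indist P a)" and C: "C \<subseteq> AG"
    and ij: "(i, j) \<in> coalition_indist P C"
  shows "rho P C i = rho P C j"
proof -
  have "(i, k) \<in> indist P a \<longleftrightarrow> (j, k) \<in> indist P a" if "a \<in> C" for a k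
  proof -
    have "equiv (index P) (indist P a)" and "(i, j) \<in> indist P a"
      using eq C ij that by (auto simp: coalition_indist_def)
    then show ?thesis
      by (metis equivE symE transE)
  qed
  then have "(i, k) \<in> coalition_indist P C \<longleftrightarrow> (j, k) \<in> coalition_indist P C" for k
    using ij by (auto simp: coalition_indist_def)
  then show ?thesis
    by (simp add: rho_def)
qed

text \<open>The empty coalition relates all indices, so the index drops out; this is why
  \<open>N {} s\<close> has at most one element.\<close>

lemma rho_empty:
  "i \<in> index P \<Longrightarrow> rho P {} i = \<Union> (outcome P ` index P)"
  by (auto simp: rho_def coalition_indist_def)

text \<open>Grand compatibility makes all sets in the union equal, and reflexivity puts
  \<open>outcome P i\<close> among them.\<close>

lemma rho_grand:
  assumes "abstract_presentation_at AG ST N s P" "i \<in> index P"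
  shows "rho P AG i = outcome P i"
proof -
  have "(i, i) \<in> coalition_indist P AG"
    using assms by (intro coalition_indist_refl[of AG]) (auto simp: abstract_presentation_at_def)
  moreover have "outcome P j = outcome P i" if "(i, j) \<in> coalition_indist P AG" for j
    using assms that unfolding abstract_presentation_at_def by metis
  ultimately show ?thesis
    using assms(2) unfolding rho_def by blast
qed

section \<open>The profile cover of a presentation\<close>

lemma presentation_imp_cover:
  assumes P: "abstract_presentation_at AG ST N s P"
  shows "\<exists>\<Omega>. coherent_profile_cover AG N s \<Omega>"
proof
  \<comment> \<open>Profiles are extensional functions on \<open>Pow AG\<close>, hence
    \<open>restrict\<close>.\<close>
  define g where "g i = restrict (\<lambda>C. rho P C i) (Pow AG)" for i
  define \<Omega> where "\<Omega> = g ` index P"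
  have eq: "\<forall>a\<in>AG. equiv (index P) (indist P a)"
    and cov: "\<And>C. C \<subseteq> AG \<Longrightarrow> N C s = {rho P C i | i. i \<in> index P}"
    using P by (auto simp: abstract_presentation_at_def)
  have g: "g i C = rho P C i" if "C \<subseteq> AG" for i C
    using that by (simp add: g_def)
  have "\<Omega> \<subseteq> power_profiles AG N s"
  proof -
    have "g i \<in> power_profiles AG N s" if "i \<in> index P" for i
      unfolding power_profiles_def
    proof (intro CollectI conjI allI impI)
      show "g i \<in> (\<Pi>\<^sub>E C\<in>Pow AG. N C s)"
        unfolding g_def using that by (auto simp: cov)
      show "g i D \<subseteq> g i C" if "C \<subseteq> D" "D \<subseteq> AG" for C D
        using that g[of C i] g[of D i] rho_antimono[of C D P i] by auto
    qed
    then show ?thesis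
      by (auto simp: \<Omega>_def)
  qed
  moreover have "coherent AG \<Omega>"
    unfolding coherent_def
  proof (intro ballI allI impI)
    fix \<gamma> C assume "\<gamma> \<in> \<Omega>" and C: "C \<subseteq> AG"
    then obtain i where i: "i \<in> index P" "\<gamma> = g i"
      by (auto simp: \<Omega>_def)
    show "\<gamma> C = \<Union> {\<delta> AG | \<delta>. \<delta> \<in> \<Omega> \<and> profile_equiv C \<delta> \<gamma>}"
    proof
      show "\<gamma> C \<subseteq> \<Union> {\<delta> AG | \<delta>. \<delta> \<in> \<Omega> \<and> profile_equiv C \<delta> \<gamma>}"
      proof
        \<comment> \<open>A point of \<open>rho P C i\<close> lies in the outcome of some related
          \<open>j\<close>; the profile of this \<open>j\<close> is the witness.\<close>
        fix t assume "t \<in> \<gamma> C"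
        then obtain j where j: "j \<in> index P" "(i, j) \<in> coalition_indist P C" "t \<in> outcome P j"
          using g[OF C] i by (auto simp: rho_def)
        have "profile_equiv C (g j) \<gamma>"
          unfolding profile_equiv_def
        proof (intro allI impI)
          fix D assume D: "D \<subseteq> C"
          then have "rho P D i = rho P D j"
            using rho_eq[OF eq, of D i j] coalition_indist_antimono[OF D, of P] j C by blast
          then show "g j D = \<gamma> D"
            using D C g[of D] i by simp
        qed
        moreover have "t \<in> g j AG"
          using j g[of AG j] rho_grand[OF P] by simp
        ultimately show "t \<in> \<Union> {\<delta> AG | \<delta>. \<delta> \<in> \<Omega> \<and> profile_equiv C \<delta> \<gamma>}"
          using j by (auto simp: \<Omega>_def)
      qed
      \<comment> \<open>Monotonicity of the profile \<delta> suffices here, as its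
        \<open>C\<close>-component is that of \<gamma>.\<close>
      have "\<delta> AG \<subseteq> \<gamma> C" if "\<delta> \<in> \<Omega>" "profile_equiv C \<delta> \<gamma>" for \<delta>
      proof -
        have "\<delta> AG \<subseteq> \<delta> C"
          using that(1) subsetD[OF rho_antimono[OF C]] by (auto simp: \<Omega>_def g[OF C] g[OF subset_refl])
        then show ?thesis
          using that(2) by (simp add: profile_equiv_def)
      qed
      then show "\<Union> {\<delta> AG | \<delta>. \<delta> \<in> \<Omega> \<and> profile_equiv C \<delta> \<gamma>} \<subseteq> \<gamma> C"
        by blast
    qed
  qed
  moreover have "N C s = {\<gamma> C | \<gamma>. \<gamma> \<in> \<Omega>}" if "C \<subseteq> AG" for C
    unfolding cov[OF that] g[OF that, symmetric] \<Omega>_def by blast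
  ultimately show "coherent_profile_cover AG N s \<Omega>"
    by (simp add: coherent_profile_cover_def)
qed

text \<open>The type \<open>'i\<close> stays arbitrary, so a presentation over any index type will
  do.\<close>

lemma abstract_imp_representative:
  assumes "AC_abstract_representative TYPE('i) AG ST N"
  shows "AC_representative AG ST N"
proof -
  obtain I :: "'b \<Rightarrow> ('i, 'a, 'b) presentation"
    where I: "\<And>s. s \<in> ST \<Longrightarrow> abstract_presentation_at AG ST N s (I s)" and "live AG ST N"
    using assms by (auto simp: AC_abstract_representative_def)
  moreover have "is_singleton (N {} s)" if "s \<in> ST" "N {} s \<noteq> {}" for s
  proof -
    have "N {} s = {rho (I s) {} i | i. i \<in> index (I s)}"
      using I[OF that(1)] by (auto simp: abstract_presentation_at_def)
    then have "N {} s \<subseteq> {\<Union> (outcome (I s) ` index (I s))}"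
      by (auto simp: rho_empty)
    then show ?thesis
      using that(2) by (metis is_singletonI subset_singletonD)
  qed
  ultimately show ?thesis
    unfolding AC_representative_def using presentation_imp_cover[OF I] by simp
qed

subsection \<open>From covers to presentations\<close>

text \<open>For finite \<open>D\<close> this is the iterated symmetric difference of the sets
  \<open>f a\<close>.\<close>

definition parity_sum :: "'a set \<Rightarrow> ('a \<Rightarrow> 'b set) \<Rightarrow> 'b set" where
  "parity_sum D f = {t. odd (card {a \<in> D. t \<in> f a})}"

lemma parity_sum_cong:
  assumes "\<And>a. a \<in> D \<Longrightarrow> f a = g a"
  shows "parity_sum D f = parity_sum D g"
proof -
  have "{a \<in> D. t \<in> f a} = {a \<in> D. t \<in> g a}" for t
    using assms by auto
  then show ?thesis
    by (simp add: parity_sum_def)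
qed

text \<open>Sets form a group under symmetric difference, so the equation with value
  \<open>W\<close> can be solved for the summand at \<open>b\<close>: it is the symmetric difference
  of \<open>W\<close> and the sum of the others.\<close>

lemma parity_sum_adjust:
  assumes "finite D" "b \<in> D"
  shows "parity_sum D (f(b := {t. (t \<in> W) \<noteq> (t \<in> parity_sum (D - {b}) f)})) = W"
    (is "parity_sum D ?g = W")
proof -
  have "t \<in> parity_sum D ?g \<longleftrightarrow> t \<in> W" for t
  proof -
    have "{a \<in> D. t \<in> ?g a} =
        (if t \<in> ?g b then insert b {a \<in> D - {b}. t \<in> f a} else {a \<in> D - {b}. t \<in> f a})"
      using assms(2) by (auto split: if_splits)
    then show ?thesis
      using assms(1) by (auto simp: parity_sum_def)
  qed
  then show ?thesis
    by blast
qed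

section \<open>Splitting profiles into shares\<close>

text \<open>The empty coalition is left out because an empty sum is always the empty set.\<close>

definition shares :: "'ag set \<Rightarrow> ('ag, 'st) index_universe \<Rightarrow> ('ag set \<Rightarrow> 'st set) \<Rightarrow> bool" where
  "shares AG x \<gamma> \<longleftrightarrow> (\<forall>D. D \<subseteq> AG \<longrightarrow> D \<noteq> {} \<longrightarrow> \<gamma> D = parity_sum D (\<lambda>a. x a D))"

text \<open>Each coalition has shares of its own, so the equations for different \<open>D\<close>
  are solved independently: old shares serve when \<open>D\<close> lies in \<open>C\<close>, and
  otherwise one member outside \<open>C\<close> absorbs the correction.\<close>

lemma shares_extend:
  assumes "finite AG"
    and agree: "\<And>D. D \<subseteq> C \<Longrightarrow> D \<subseteq> AG \<Longrightarrow> D \<noteq> {} \<Longrightarrow> \<delta> D = parity_sum D (\<lambda>a. x a D)"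
  shows "\<exists>y. shares AG y \<delta> \<and> (\<forall>a\<in>C. y a = x a)"
proof -
  \<comment> \<open>\<open>b D\<close> is the member of \<open>D\<close> outside \<open>C\<close>
    whose share will be changed.\<close>
  have "\<exists>b. \<forall>D. \<not> D \<subseteq> C \<longrightarrow> b D \<in> D - C"
    by (rule choice) blast
  then obtain b where b: "\<And>D. \<not> D \<subseteq> C \<Longrightarrow> b D \<in> D - C"
    by blast
  \<comment> \<open>The coalition comes first in \<open>z\<close> so that the update acts on agents;
    the arguments are swapped back afterwards.\<close>
  define z where "z D = (if D \<subseteq> C then (\<lambda>a. x a D)
      else (\<lambda>a. x a D)(b D := {t. (t \<in> \<delta> D) \<noteq> (t \<in> parity_sum (D - {b D}) (\<lambda>a. x a D))}))" for D
  have "shares AG (\<lambda>a D. z D a) \<delta>"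
    unfolding shares_def
  proof (intro allI impI)
    fix D assume D: "D \<subseteq> AG" "D \<noteq> {}"
    show "\<delta> D = parity_sum D (\<lambda>a. z D a)"
    proof (cases "D \<subseteq> C")
      case True
      then show ?thesis
        using agree D by (simp add: z_def)
    next
      case False
      have "finite D"
        using D assms(1) finite_subset by blast
      then show ?thesis
        using False b[OF False] parity_sum_adjust[of D "b D" "\<lambda>a. x a D" "\<delta> D"]
        by (simp add: z_def flip: fun_upd_apply)
    qed
  qed
  moreover have "(\<lambda>D. z D a) = x a" if "a \<in> C" for a
  proof
    fix D
    have "a \<noteq> b D" if "\<not> D \<subseteq> C"
      using b[OF that] \<open>a \<in> C\<close> by auto
    then show "z D a = x a D"
      by (simp add: z_def)
  qed
  ultimately show ?thesis
    by (intro exI[of _ "\<lambda>a D. z D a"]) auto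
qed

section \<open>The presentation of a cover\<close>

lemma cover_imp_presentation:
  fixes AG :: "'ag set" and N :: "('ag, 'st) nbhd"
  assumes fin: "finite AG" and ne: "AG \<noteq> {}"
    and grand: "N AG s \<subseteq> Pow ST"
    and single: "\<And>X Y. X \<in> N {} s \<Longrightarrow> Y \<in> N {} s \<Longrightarrow> X = Y"
    and cover: "coherent_profile_cover AG N s \<Omega>"
  shows "\<exists>P :: (('ag, 'st) index_universe, 'ag, 'st) presentation.
           abstract_presentation_at AG ST N s P"
proof
  \<comment> \<open>All share families of all profiles in the cover are taken, not one per profile,
    so that those produced by \<open>shares_extend\<close> are indices too.\<close>
  define I where "I = {x. \<exists>\<gamma>\<in>\<Omega>. shares AG x \<gamma>}"
  \<comment> \<open>The outcome is computed from the shares alone, so agents' joint agreement fixes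
    it and grand compatibility follows.\<close>
  define P :: "(('ag, 'st) index_universe, 'ag, 'st) presentation" where
    "P = \<lparr>index = I, outcome = (\<lambda>x. parity_sum AG (\<lambda>a. x a AG)),
          indist = (\<lambda>a. {(x, y). x \<in> I \<and> y \<in> I \<and> x a = y a})\<rparr>"
  have coh: "coherent AG \<Omega>"
    and cov: "\<And>C. C \<subseteq> AG \<Longrightarrow> N C s = {\<gamma> C | \<gamma>. \<gamma> \<in> \<Omega>}"
    using cover by (auto simp: coherent_profile_cover_def)
  have ind: "(x, y) \<in> coalition_indist P C \<longleftrightarrow> x \<in> I \<and> y \<in> I \<and> (\<forall>a\<in>C. x a = y a)" for x y C
    by (auto simp: P_def coalition_indist_def)
  have idx: "index P = I"
    by (simp add: P_def)
  \<comment> \<open>As \<open>AG\<close> is nonempty, its component is encoded in the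
    shares.\<close>
  have out: "outcome P x = \<gamma> AG" if "shares AG x \<gamma>" for x \<gamma>
    using that ne by (simp add: shares_def P_def)
  \<comment> \<open>The outcomes of indices \<open>C\<close>-related to \<open>x\<close> are exactly
    the sets \<open>\<delta> AG\<close> whose union coherence equates with
    \<open>\<gamma> C\<close>; the two inclusions follow.\<close>
  have rho: "rho P C x = \<gamma> C" if x: "\<gamma> \<in> \<Omega>" "shares AG x \<gamma>" and C: "C \<subseteq> AG" for \<gamma> x C
  proof -
    have xI: "x \<in> I"
      using x by (auto simp: I_def)
    have "\<exists>\<delta>. outcome P y = \<delta> AG \<and> \<delta> \<in> \<Omega> \<and> profile_equiv C \<delta> \<gamma>"
      if y: "y \<in> I" "\<forall>a\<in>C. x a = y a" for y
    proof -
      obtain \<delta> where \<delta>: "\<delta> \<in> \<Omega>" "shares AG y \<delta>"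
        using y by (auto simp: I_def)
      have "\<delta> D = \<gamma> D" if D: "D \<subseteq> C" for D
      proof (cases "D = {}")
        \<comment> \<open>Shares say nothing about the empty coalition; its component is fixed
          because \<open>N {} s\<close> has at most one element.\<close>
        case True
        then show ?thesis
          using single[of "\<delta> {}" "\<gamma> {}"] cov[of "{}"] \<delta> x by blast
      next
        case False
        have "parity_sum D (\<lambda>a. y a D) = parity_sum D (\<lambda>a. x a D)"
          using D y(2) by (intro parity_sum_cong) auto
        then show ?thesis
          using False D C \<delta>(2) x(2) by (simp add: shares_def)
      qed
      then show ?thesis
        using \<delta> out by (auto simp: profile_equiv_def)
    qed
    moreover have "\<exists>y. y \<in> I \<and> (\<forall>a\<in>C. x a = y a) \<and> outcome P y = \<delta> AG"
      if \<delta>: "\<delta> \<in> \<Omega>" "profile_equiv C \<delta> \<gamma>" for \<delta>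
    proof -
      \<comment> \<open>Since \<delta> and \<gamma> agree below \<open>C\<close>, the shares
        \<open>x\<close> already encode \<delta> there and can be kept for all members of
        \<open>C\<close>.\<close>
      have "\<exists>y. shares AG y \<delta> \<and> (\<forall>a\<in>C. y a = x a)"
        using \<delta>(2) x(2) by (intro shares_extend[OF fin]) (auto simp: profile_equiv_def shares_def)
      then show ?thesis
        using \<delta>(1) out unfolding I_def by force
    qed
    ultimately have "{outcome P y | y. y \<in> index P \<and> (x, y) \<in> coalition_indist P C} =
        {\<delta> AG | \<delta>. \<delta> \<in> \<Omega> \<and> profile_equiv C \<delta> \<gamma>}"
      using xI unfolding ind idx by (intro Collect_eqI iffI; metis)
    then show ?thesis
      using coh x(1) C by (simp add: rho_def coherent_def)
  qed
  \<comment> \<open>For the empty \<open>C\<close> only the empty coalition could need agreement,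
    and it is exempt; so every profile has an index and coverage loses nothing.\<close>
  have ex: "\<exists>x. shares AG x \<gamma>" for \<gamma> :: "'ag set \<Rightarrow> 'st set"
    using shares_extend[OF fin, of "{}"] by blast
  show "abstract_presentation_at AG ST N s P"
    unfolding abstract_presentation_at_def
  proof (intro conjI allI impI)
    show "outcome P \<in> index P \<rightarrow> Pow ST"
    proof
      fix x assume "x \<in> index P"
      then obtain \<gamma> where "\<gamma> \<in> \<Omega>" "shares AG x \<gamma>"
        by (auto simp: P_def I_def)
      then show "outcome P x \<in> Pow ST"
        using grand cov[of AG] out by auto
    qed
    show "\<forall>a\<in>AG. equiv (index P) (indist P a)"
      by (auto simp: P_def equiv_def refl_on_def sym_def trans_def)
    show "outcome P x = outcome P y" if "(x, y) \<in> coalition_indist P AG" for x y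
      using that parity_sum_cong[of AG "\<lambda>a. x a AG" "\<lambda>a. y a AG"] unfolding ind by (simp add: P_def)
    show "N C s = {rho P C x | x. x \<in> index P}" if C: "C \<subseteq> AG" for C
    proof -
      have "{rho P C x | x. x \<in> index P} = {\<gamma> C | \<gamma>. \<gamma> \<in> \<Omega>}"
      proof (intro set_eqI iffI)
        fix X assume "X \<in> {rho P C x | x. x \<in> index P}"
        then show "X \<in> {\<gamma> C | \<gamma>. \<gamma> \<in> \<Omega>}"
          using rho[OF _ _ C] by (auto simp: P_def I_def)
      next
        fix X assume "X \<in> {\<gamma> C | \<gamma>. \<gamma> \<in> \<Omega>}"
        then obtain \<gamma> x where "X = \<gamma> C" "\<gamma> \<in> \<Omega>" "shares AG x \<gamma>"
          using ex by blast
        moreover from this have "x \<in> index P"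
          by (auto simp: P_def I_def)
        ultimately show "X \<in> {rho P C x | x. x \<in> index P}"
          using rho[OF _ _ C] by blast
      qed
      then show ?thesis
        using cov[OF C] by simp
    qed
  qed
qed

section \<open>Assembling the equivalence over all states\<close>

lemma representative_imp_abstract:
  fixes AG :: "'ag set" and ST :: "'st set" and N :: "('ag, 'st) nbhd"
  assumes "finite AG" "AG \<noteq> {}" "actual_neighborhood_frame AG ST N"
    and rep: "AC_representative AG ST N"
  shows "AC_abstract_representative TYPE(('ag, 'st) index_universe) AG ST N"
proof -
  have "\<exists>P :: (('ag, 'st) index_universe, 'ag, 'st) presentation.
          abstract_presentation_at AG ST N s P" if s: "s \<in> ST" for s
  proof -
    obtain \<Omega> where \<Omega>: "coherent_profile_cover AG N s \<Omega>"
      using rep s by (auto simp: AC_representative_def)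
    have single: "X = Y" if "X \<in> N {} s" "Y \<in> N {} s" for X Y
    proof -
      have "is_singleton (N {} s)"
        using rep s that by (auto simp: AC_representative_def)
      then show ?thesis
        using that by (auto simp: is_singleton_def)
    qed
    have "N AG s \<subseteq> Pow ST"
      using assms(3) s by (auto simp: actual_neighborhood_frame_def)
    from assms(1,2) this single \<Omega> show ?thesis
      by (rule cover_imp_presentation)
  qed
  then have "\<exists>\<I> :: 'st \<Rightarrow> (('ag, 'st) index_universe, 'ag, 'st) presentation.
      \<forall>s\<in>ST. abstract_presentation_at AG ST N s (\<I> s)"
    by (intro bchoice ballI)
  then show ?thesis
    using rep by (simp add: AC_abstract_representative_def AC_representative_def)
qed

text \<open>The second conjunct shows that no index type \<open>'i\<close> represents more frames
  than \<open>index_universe\<close> does, which stands in for quantification over all index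
  sets.\<close>

theorem theorem7:
  fixes AG :: "'ag set" and ST :: "'st set" and N :: "('ag, 'st) nbhd"
  assumes "finite AG" and "AG \<noteq> {}"
    and "actual_neighborhood_frame AG ST N"
  shows "(AC_representative AG ST N \<longleftrightarrow>
            AC_abstract_representative TYPE(('ag, 'st) index_universe) AG ST N) \<and>
         (AC_abstract_representative TYPE('i) AG ST N \<longrightarrow> AC_representative AG ST N)"
  by (intro conjI iffI impI) (erule representative_imp_abstract[OF assms] abstract_imp_representative)+

end
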